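(* Let $\mathcal{H}$ be a complex Hilbert space, let $A\in\mathcal{B}(\mathcal{H})$ be a positive operator, and let $T\in\mathcal{B}_A(\mathcal{H})$. Then $$w_A(T)\geq \frac{\|T\|_A}{2}+\frac{\big|\, \|\Re_A(T)\|_A-\|\Im_A(T)\|_A\,\big|}{2}.$$
   Context: $\mathcal{B}(\mathcal{H})$ is the algebra of bounded linear operators on the complex Hilbert space $\mathcal{H}$ with inner product $\langle\cdot,\cdot\rangle$; $A\in\mathcal{B}(\mathcal{H})$ is positive (i.e. $\langle Ax,x\rangle\ge 0$ for all $x$), not necessarily injective. Put $\langle x,y\rangle_A=\langle Ax,y\rangle$ and $\|x\|_A=\sqrt{\langle x,x\rangle_A}$ (a seminorm on $\mathcal{H}$). $R(S)$ denotes the range of $S$ and $\overline{R(S)}$ its norm closure. $\mathcal{B}_A(\mathcal{H})=\{T\in\mathcal{B}(\mathcal{H}): R(T^*A)\subseteq R(A)\}$, equivalently the set of $T\in\mathcal{B}(\mathcal{H})$ for which there is $S\in\mathcal{B}(\mathcal{H})$ with $AS=T^*A$. For $T\in\mathcal{B}_A(\mathcal{H})$, $T^{\sharp_A}$ denotes the unique $X\in\mathcal{B}(\mathcal{H})$ with $AX=T^*A$ and $R(X)\subseteq\overline{R(A)}$. For $T\in\mathcal{B}_A(\mathcal{H})$: $\|T\|_A=\sup\{\|Tx\|_A: x\in\overline{R(A)},\ \|x\|_A=1\}=\sup\{\|Tx\|_A: x\in\mathcal{H},\ \|x\|_A=1\}$ (finite), and $w_A(T)=\sup\{|\langle Tx,x\rangle_A|: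 x\in\mathcal{H},\ \|x\|_A=1\}$. Finally $\Re_A(T)=\frac{T+T^{\sharp_A}}{2}$ and $\Im_A(T)=\frac{T-T^{\sharp_A}}{2\mathrm{i}}$. *)

theory Defs
  imports "HOL-Analysis.Analysis" "HOL-Library.Nonpos_Ints"
begin

class complex_vector = real_vector +
  fixes scaleC :: "complex \<Rightarrow> 'a \<Rightarrow> 'a"  (infixr \<open>*\<^sub>C\<close> 75)
  assumes scaleC_add_right: "c *\<^sub>C (x + y) = c *\<^sub>C x + c *\<^sub>C y"
    and scaleC_add_left: "(c + d) *\<^sub>C x = c *\<^sub>C x + d *\<^sub>C x"
    and scaleC_scaleC: "c *\<^sub>C d *\<^sub>C x = (c * d) *\<^sub>C x"
    and scaleR_scaleC: "r *\<^sub>R x = complex_of_real r *\<^sub>C x"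

text \<open>The inner product is linear in the first and conjugate-linear in the second argument.\<close>

class complex_inner = complex_vector + real_normed_vector +
  fixes cinner :: "'a \<Rightarrow> 'a \<Rightarrow> complex"
  assumes cinner_commute: "cinner x y = cnj (cinner y x)"
    and cinner_add_left: "cinner (x + y) z = cinner x z + cinner y z"
    and cinner_scaleC_left: "cinner (c *\<^sub>C x) y = c * cinner x y"
    and cinner_ge_zero: "cinner x x \<in> \<real>\<^sub>\<ge>\<^sub>0"
    and cinner_eq_zero_iff: "cinner x x = 0 \<longleftrightarrow> x = 0"
    and norm_eq_sqrt_cinner: "norm x = sqrt (Re (cinner x x))"

class chilbert_space = complex_inner + complete_space

instantiation complex :: chilbert_space
begin

definition scaleC_complex :: "complex \<Rightarrow> complex \<Rightarrow> complex"
  where "scaleC_complex c x = c * x"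

definition cinner_complex :: "complex \<Rightarrow> complex \<Rightarrow> complex"
  where "cinner_complex x y = x * cnj y"

instance
proof
  fix x y z c d :: complex and r :: real
  show "c *\<^sub>C (x + y) = c *\<^sub>C x + c *\<^sub>C y" "(c + d) *\<^sub>C x = c *\<^sub>C x + d *\<^sub>C x"
    "c *\<^sub>C d *\<^sub>C x = (c * d) *\<^sub>C x" "r *\<^sub>R x = complex_of_real r *\<^sub>C x"
    by (simp_all add: scaleC_complex_def algebra_simps scaleR_conv_of_real)
  show "cinner x y = cnj (cinner y x)" "cinner (x + y) z = cinner x z + cinner y z"
    "cinner (c *\<^sub>C x) y = c * cinner x y" "cinner x x = 0 \<longleftrightarrow> x = 0"
    by (simp_all add: scaleC_complex_def cinner_complex_def algebra_simps)
  show "cinner x x \<in> \<real>\<^sub>\<ge>\<^sub>0"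
    by (simp add: cinner_complex_def complex_nonneg_Reals_iff)
  show "norm x = sqrt (Re (cinner x x))"
    by (simp add: cinner_complex_def complex_mult_cnj cmod_def)
qed

end

definition bounded_clinear :: "('a::complex_inner \<Rightarrow> 'a) \<Rightarrow> bool"
  where "bounded_clinear T \<longleftrightarrow> bounded_linear T \<and> (\<forall>c x. T (c *\<^sub>C x) = c *\<^sub>C T x)"

definition positive_op :: "('a::complex_inner \<Rightarrow> 'a) \<Rightarrow> bool"
  where "positive_op A \<longleftrightarrow> bounded_clinear A \<and> (\<forall>x. cinner (A x) x \<in> \<real>\<^sub>\<ge>\<^sub>0)"

definition cadjoint :: "('a::chilbert_space \<Rightarrow> 'a) \<Rightarrow> ('a \<Rightarrow> 'a)"
  where "cadjoint T = (THE S. bounded_clinear S \<and> (\<forall>x y. cinner (T x) y = cinner x (S y)))"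

definition A_inner :: "('a::complex_inner \<Rightarrow> 'a) \<Rightarrow> 'a \<Rightarrow> 'a \<Rightarrow> complex"
  where "A_inner A x y = cinner (A x) y"

definition A_seminorm :: "('a::complex_inner \<Rightarrow> 'a) \<Rightarrow> 'a \<Rightarrow> real"
  where "A_seminorm A x = sqrt (Re (A_inner A x x))"

definition A_bounded :: "('a::chilbert_space \<Rightarrow> 'a) \<Rightarrow> ('a \<Rightarrow> 'a) set"
  where "A_bounded A = {T. bounded_clinear T \<and> range (cadjoint T \<circ> A) \<subseteq> range A}"

definition A_sharp :: "('a::chilbert_space \<Rightarrow> 'a) \<Rightarrow> ('a \<Rightarrow> 'a) \<Rightarrow> ('a \<Rightarrow> 'a)"
  where "A_sharp A T = (THE X. bounded_clinear X \<and> A \<circ> X = cadjoint T \<circ> A \<and>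
           range X \<subseteq> closure (range A))"

text \<open>
  Inserting 0 into the sets of (nonnegative) values implements the convention that the supremum
  of the empty set is 0. The sets of values are empty exactly for \<open>A = 0\<close>; there the supremum
  of the empty set in type \<^typ>\<open>real\<close> would be an unspecified number.
\<close>

definition A_norm :: "('a::complex_inner \<Rightarrow> 'a) \<Rightarrow> ('a \<Rightarrow> 'a) \<Rightarrow> real"
  where "A_norm A T =
    Sup (insert 0 {A_seminorm A (T x) | x. x \<in> closure (range A) \<and> A_seminorm A x = 1})"

definition A_numerical_radius :: "('a::complex_inner \<Rightarrow> 'a) \<Rightarrow> ('a \<Rightarrow> 'a) \<Rightarrow> real"
  where "A_numerical_radius A T =
    Sup (insert 0 {cmod (A_inner A (T x) x) | x. A_seminorm A x = 1})"

definition A_Re :: "('a::chilbert_space \<Rightarrow> 'a) \<Rightarrow> ('a \<Rightarrow> 'a) \<Rightarrow> ('a \<Rightarrow> 'a)"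
  where "A_Re A T = (\<lambda>x. (1 / 2) *\<^sub>C (T x + A_sharp A T x))"

definition A_Im :: "('a::chilbert_space \<Rightarrow> 'a) \<Rightarrow> ('a \<Rightarrow> 'a) \<Rightarrow> ('a \<Rightarrow> 'a)"
  where "A_Im A T = (\<lambda>x. (1 / (2 * \<i>)) *\<^sub>C (T x - A_sharp A T x))"

end

theory Submission
  imports Defs
begin

text \<open>
  Both \<open>\<Re>\<^sub>A(T)\<close> and \<open>\<Im>\<^sub>A(T)\<close> are selfadjoint for \<open>\<langle>\<cdot>,\<cdot>\<rangle>\<^sub>A\<close>, and their quadratic forms are the real
  and imaginary part of \<open>\<langle>Tx,x\<rangle>\<^sub>A\<close>. By polarization the seminorm of an \<open>A\<close>-selfadjoint operator is
  bounded by its numerical radius, so \<open>w\<^sub>A(T)\<close> is at least \<open>max a b\<close>, where \<open>a\<close> and \<open>b\<close> are the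
  seminorms of \<open>\<Re>\<^sub>A(T)\<close> and \<open>\<Im>\<^sub>A(T)\<close>. Now \<open>max a b = (a + b)/2 + \<bar>a - b\<bar>/2\<close>, and \<open>a + b\<close> dominates
  the seminorm of \<open>T\<close> because \<open>T = \<Re>\<^sub>A(T) + i \<Im>\<^sub>A(T)\<close>.

  The existence of \<open>T\<^sup>\<sharp>\<close> rests on the orthogonal projection onto the closure of the range of \<open>A\<close>; it
  is bounded by the uniform boundedness principle, since \<open>\<langle>T\<^sup>\<sharp>x, Av\<rangle> = \<langle>x, ATv\<rangle>\<close>.
\<close>

section \<open>Uniform boundedness\<close>

text \<open>Baire category: the closed sets \<open>C n\<close> of points at which the whole family
  is bounded by \<open>n\<close> cover the complete space, so one of them contains a ball.
  Differences of points of that ball bound the family in every direction.\<close>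

lemma uniform_boundedness:
  fixes f :: "'i \<Rightarrow> 'a::{real_normed_vector,complete_space} \<Rightarrow> 'b::real_normed_vector"
  assumes lin: "\<And>i. i \<in> I \<Longrightarrow> bounded_linear (f i)"
    and bdd: "\<And>x. \<exists>c. \<forall>i\<in>I. norm (f i x) \<le> c"
  obtains K where "K \<ge> 0" "\<And>i x. i \<in> I \<Longrightarrow> norm (f i x) \<le> K * norm x"
proof -
  define C where "C n = (\<Inter>i\<in>I. {x. norm (f i x) \<le> real n})" for n
  have cl: "closed (C n)" for n
    unfolding C_def
    by (intro closed_INT ballI closed_Collect_le continuous_intros)
      (auto intro: lin linear_continuous_on)
  have "\<exists>n. x \<in> C n" for x
  proof -
    obtain c where c: "\<forall>i\<in>I. norm (f i x) \<le> c"
      using bdd by blast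
    obtain n where "c \<le> real n"
      using real_arch_simple by blast
    then show ?thesis
      using c unfolding C_def by (auto intro!: exI[of _ n] intro: order_trans)
  qed
  then have "(\<Union>n. C n) = UNIV"
    by blast
  then have "interior (\<Union>(range C)) \<noteq> {}"
    by simp
  moreover have "euclidean interior_of \<Union>(range C) = {}"
    if "\<And>n. interior (C n) = {}"
    using that cl
    by (intro Baire_category_alt) (auto simp: completely_metrizable_space_euclidean)
  ultimately obtain n where "interior (C n) \<noteq> {}"
    by auto
  then obtain a e where e: "e > 0" and ball: "cball a e \<subseteq> C n"
    by (metis equals0I mem_interior_cball)
  have a: "a \<in> C n"
    using e ball by auto
  show thesis
  proof
    show "2 * real n / e \<ge> 0"
      using e by simp
    fix i x assume i: "i \<in> I"
    interpret bounded_linear "f i"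
      by (rule lin[OF i])
    show "norm (f i x) \<le> 2 * real n / e * norm x"
    proof (cases "x = 0")
      case False
      \<comment> \<open>This scaling puts \<open>a + t *\<^sub>R x\<close> on the boundary of the
        ball. Both it and the centre lie in \<open>C n\<close>, hence the factor 2 in the
        constant.\<close>
      define t where "t = e / norm x"
      have t: "t > 0"
        using False e by (simp add: t_def)
      have "a + t *\<^sub>R x \<in> C n"
        using False e by (intro subsetD[OF ball]) (simp add: t_def dist_norm)
      then have "norm (f i (a + t *\<^sub>R x)) \<le> n" "norm (f i a) \<le> n"
        using a i by (auto simp: C_def)
      moreover have "f i (a + t *\<^sub>R x) - f i a = t *\<^sub>R f i x"
        by (simp add: add scaleR)
      ultimately have "norm (t *\<^sub>R f i x) \<le> 2 * real n"
        by (metis add_mono mult_2 norm_triangle_ineq4 order_trans)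
      then have "t * norm (f i x) \<le> 2 * real n"
        using t by simp
      then have "norm (f i x) \<le> 2 * real n / t"
        using t by (simp add: field_simps)
      then show ?thesis
        by (simp add: t_def)
    qed (simp add: zero)
  qed
qed

section \<open>The semi-inner product of a positive operator\<close>

lemma scaleC_one [simp]: "1 *\<^sub>C (x::'a::complex_vector) = x"
  using scaleR_scaleC[of 1 x] by simp

lemma scaleC_minus_one [simp]: "(-1) *\<^sub>C (x::'a::complex_vector) = - x"
  using scaleR_scaleC[of "-1" x] by simp

lemma scaleC_minus_right: "c *\<^sub>C (- x) = - (c *\<^sub>C (x::'a::complex_vector))"
  by (metis mult.commute scaleC_minus_one scaleC_scaleC)

lemma scaleC_diff_right: "c *\<^sub>C (x - y) = c *\<^sub>C x - c *\<^sub>C (y::'a::complex_vector)"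
  by (metis diff_conv_add_uminus scaleC_add_right scaleC_minus_right)

lemma cinner_add_right: "cinner x (y + z) = cinner x y + cinner x (z::'a::complex_inner)"
  by (metis cinner_add_left cinner_commute complex_cnj_add)

lemma cinner_scaleC_right: "cinner x (c *\<^sub>C y) = cnj c * cinner x (y::'a::complex_inner)"
  by (metis cinner_scaleC_left cinner_commute complex_cnj_mult)

lemma cinner_minus_left: "cinner (- x) y = - cinner x (y::'a::complex_inner)"
  by (metis cinner_scaleC_left mult_minus1 scaleC_minus_one)

lemma cinner_minus_right: "cinner x (- y) = - cinner x (y::'a::complex_inner)"
  by (metis cinner_commute cinner_minus_left complex_cnj_minus)

lemma cinner_diff_left: "cinner (x - y) z = cinner x z - cinner y (z::'a::complex_inner)"
  by (metis cinner_add_left cinner_minus_left diff_conv_add_uminus)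

lemma cinner_diff_right: "cinner x (y - z) = cinner x y - cinner x (z::'a::complex_inner)"
  by (metis cinner_add_right cinner_minus_right diff_conv_add_uminus)

lemma cinner_zero_left [simp]: "cinner 0 (y::'a::complex_inner) = 0"
  using cinner_diff_left[of 0 0 y] by simp

lemma cinner_zero_right [simp]: "cinner (y::'a::complex_inner) 0 = 0"
  using cinner_diff_right[of y 0 0] by simp

lemmas cinner_algebra = cinner_add_left cinner_add_right cinner_diff_left cinner_diff_right
  cinner_minus_left cinner_minus_right cinner_scaleC_left cinner_scaleC_right

lemma cinner_ext:
  fixes x y :: "'a::complex_inner"
  assumes "\<And>z. cinner z x = cinner z y"
  shows "x = y"
proof -
  have "cinner (x - y) (x - y) = 0"
    using assms by (simp add: cinner_diff_right)
  then show ?thesis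
    by (simp add: cinner_eq_zero_iff)
qed

lemma bounded_clinearD:
  assumes "bounded_clinear T"
  shows "bounded_linear T" "T (c *\<^sub>C x) = c *\<^sub>C T x"
    "T (x + y) = T x + T y" "T (x - y) = T x - T y" "T (- x) = - T x" "T 0 = 0"
proof -
  show "bounded_linear T" "T (c *\<^sub>C x) = c *\<^sub>C T x"
    using assms by (simp_all add: bounded_clinear_def)
  then interpret bounded_linear T
    by simp
  show "T (x + y) = T x + T y" "T (x - y) = T x - T y" "T (- x) = - T x" "T 0 = 0"
    by (rule add diff neg zero)+
qed

section \<open>Form and seminorm of a positive operator\<close>

lemma positive_opD:
  assumes "positive_op A"
  shows "bounded_clinear A" "Re (A_inner A x x) \<ge> 0" "Im (A_inner A x x) = 0"
  using assms by (simp_all add: positive_op_def A_inner_def complex_nonneg_Reals_iff)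

lemma A_inner_algebra:
  assumes "bounded_clinear A"
  shows "A_inner A (x + y) z = A_inner A x z + A_inner A y z"
    "A_inner A x (y + z) = A_inner A x y + A_inner A x z"
    "A_inner A (x - y) z = A_inner A x z - A_inner A y z"
    "A_inner A x (y - z) = A_inner A x y - A_inner A x z"
    "A_inner A (c *\<^sub>C x) z = c * A_inner A x z"
    "A_inner A x (c *\<^sub>C z) = cnj c * A_inner A x z"
  by (simp_all add: A_inner_def bounded_clinearD[OF assms] cinner_algebra)

text \<open>The quadratic form is real. Evaluated at \<open>x + y\<close> this makes the imaginary
  parts opposite; evaluated at \<open>x + \<i> *\<^sub>C y\<close> it makes the real parts
  equal.\<close>

lemma A_inner_commute:
  assumes "positive_op A"
  shows "A_inner A x y = cnj (A_inner A y x)"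
proof -
  note D = positive_opD[OF assms]
  have "Im (A_inner A (x + y) (x + y)) = 0" "Im (A_inner A (x + \<i> *\<^sub>C y) (x + \<i> *\<^sub>C y)) = 0"
    by (rule D)+
  then show ?thesis
    by (simp add: A_inner_algebra[OF D(1)] D(3) complex_eq_iff)
qed

lemma A_inner_self: "positive_op A \<Longrightarrow> A_inner A x x = complex_of_real ((A_seminorm A x)\<^sup>2)"
  using positive_opD(2,3)[of A x] by (simp add: A_seminorm_def complex_eq_iff)

lemma A_seminorm_nonneg: "positive_op A \<Longrightarrow> A_seminorm A x \<ge> 0"
  using positive_opD(2)[of A x] by (simp add: A_seminorm_def)

lemma A_seminorm_scaleC:
  assumes "positive_op A"
  shows "A_seminorm A (c *\<^sub>C x) = cmod c * A_seminorm A x"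
proof -
  have "A_inner A (c *\<^sub>C x) (c *\<^sub>C x) = (c * cnj c) * A_inner A x x"
    by (simp add: A_inner_algebra[OF positive_opD(1)[OF assms]])
  also have "c * cnj c = complex_of_real ((cmod c)\<^sup>2)"
    by (rule complex_norm_square[symmetric])
  finally show ?thesis
    by (simp add: A_seminorm_def real_sqrt_mult)
qed

lemma nonneg_quadratic_discriminant:
  fixes a b c :: real
  assumes nonneg: "\<And>t. 0 \<le> a + 2 * t * b + t\<^sup>2 * c" and "c \<ge> 0"
  shows "b\<^sup>2 \<le> a * c"
proof (cases "c = 0")
  case True
  have "b = 0"
  proof (rule ccontr)
    assume "b \<noteq> 0"
    \<comment> \<open>For \<open>c = 0\<close> the quadratic is affine in \<open>t\<close>; this
      \<open>t\<close> gives it the value -1.\<close>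
    then have "2 * (- (a + 1) / (2 * b)) * b = - (a + 1)"
      by simp
    then show False
      using nonneg[of "- (a + 1) / (2 * b)"] True by simp
  qed
  then show ?thesis
    using True by simp
next
  case False
  then have "c > 0"
    using assms by simp
  then show ?thesis
    using nonneg[of "- b / c"] by (simp add: field_simps power2_eq_square)
qed

text \<open>Nonnegativity of the form at \<open>x + t y\<close> for real \<open>t\<close> bounds the
  real part through the discriminant, which also covers vectors of seminorm zero. Rotating
  \<open>x\<close> by a unimodular \<open>c\<close> that makes the product real and nonnegative then
  gives the modulus.\<close>

lemma A_Cauchy_Schwarz:
  assumes "positive_op A"
  shows "cmod (A_inner A x y) \<le> A_seminorm A x * A_seminorm A y"
proof -
  note D = positive_opD[OF assms] and self = A_inner_self[OF assms]
  have real: "\<bar>Re (A_inner A x y)\<bar> \<le> A_seminorm A x * A_seminorm A y" for x y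
  proof -
    have "0 \<le> (A_seminorm A x)\<^sup>2 + 2 * t * Re (A_inner A x y) + t\<^sup>2 * (A_seminorm A y)\<^sup>2" for t
    proof -
      have "Re (A_inner A y x) = Re (A_inner A x y)"
        by (subst A_inner_commute[OF assms]) simp
      then show ?thesis
        using D(2)[of "x + complex_of_real t *\<^sub>C y"]
        unfolding A_inner_algebra[OF D(1)] unfolding self
        by (simp add: power2_eq_square algebra_simps)
    qed
    then have "(Re (A_inner A x y))\<^sup>2 \<le> (A_seminorm A x * A_seminorm A y)\<^sup>2"
      using nonneg_quadratic_discriminant[of "(A_seminorm A x)\<^sup>2" _ "(A_seminorm A y)\<^sup>2"]
      by (simp add: power_mult_distrib)
    then show ?thesis
      using A_seminorm_nonneg[OF assms] by (simp add: abs_le_square_iff [symmetric])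
  qed
  define s where "s = A_inner A x y"
  show ?thesis
  proof (cases "s = 0")
    case False
    define c where "c = cnj s / cmod s"
    have c: "cmod c = 1"
      using False by (simp add: c_def norm_divide)
    have "c * s = cmod s"
      using False unfolding c_def
      by (simp add: complex_norm_square[symmetric] mult.commute[of "cnj s"] power2_eq_square)
    then have "cmod s = Re (A_inner A (c *\<^sub>C x) y)"
      by (simp add: A_inner_algebra[OF D(1)] s_def)
    also have "\<dots> \<le> A_seminorm A (c *\<^sub>C x) * A_seminorm A y"
      using real by (metis abs_le_D1)
    also have "A_seminorm A (c *\<^sub>C x) = A_seminorm A x"
      by (simp add: A_seminorm_scaleC[OF assms] c)
    finally show ?thesis
      by (simp add: s_def)
  qed (use A_seminorm_nonneg[OF assms] in \<open>simp add: s_def\<close>)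
qed

lemma A_seminorm_triangle:
  assumes "positive_op A"
  shows "A_seminorm A (x + y) \<le> A_seminorm A x + A_seminorm A y"
proof -
  have "Re (A_inner A x y) \<le> A_seminorm A x * A_seminorm A y"
    using A_Cauchy_Schwarz[OF assms] complex_Re_le_cmod order_trans by blast
  moreover have "Re (A_inner A y x) = Re (A_inner A x y)"
    by (subst A_inner_commute[OF assms]) simp
  ultimately have "Re (A_inner A (x + y) (x + y)) \<le> (A_seminorm A x + A_seminorm A y)\<^sup>2"
    unfolding A_inner_algebra[OF positive_opD(1)[OF assms]] unfolding A_inner_self[OF assms]
    by (simp add: power2_eq_square algebra_simps)
  then have "(A_seminorm A (x + y))\<^sup>2 \<le> (A_seminorm A x + A_seminorm A y)\<^sup>2"
    by (simp add: A_inner_self[OF assms])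
  then show ?thesis
    by (rule power2_le_imp_le) (simp add: A_seminorm_nonneg[OF assms])
qed

text \<open>With the identity as \<open>A\<close>, the facts on the semi-inner product specialize to
  Cauchy-Schwarz and homogeneity for the Hilbert space norm.\<close>

lemma positive_op_id: "positive_op (\<lambda>x. x)"
  by (simp add: positive_op_def bounded_clinear_def bounded_linear_ident cinner_ge_zero)

lemma A_inner_id: "A_inner (\<lambda>x. x) = cinner"
  by (simp add: A_inner_def fun_eq_iff)

lemma A_seminorm_id: "A_seminorm (\<lambda>x. x) = norm"
  by (simp add: A_seminorm_def A_inner_def norm_eq_sqrt_cinner fun_eq_iff)

lemmas Cauchy_Schwarz_cinner = A_Cauchy_Schwarz[OF positive_op_id, unfolded A_inner_id A_seminorm_id]
lemmas norm_scaleC = A_seminorm_scaleC[OF positive_op_id, unfolded A_seminorm_id]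
lemmas cinner_self = A_inner_self[OF positive_op_id, unfolded A_inner_id A_seminorm_id]

lemma bounded_linear_cinner_left: "bounded_linear (\<lambda>x. cinner x (y::'a::complex_inner))"
proof (rule bounded_linear_intro)
  show "norm (cinner x y) \<le> norm x * norm y" for x
    by (rule Cauchy_Schwarz_cinner)
qed (simp_all add: cinner_algebra scaleR_scaleC scaleC_complex_def)

lemma bounded_linear_cinner_right: "bounded_linear (\<lambda>y. cinner (x::'a::complex_inner) y)"
proof (rule bounded_linear_intro)
  show "norm (cinner x y) \<le> norm y * norm x" for y
    using Cauchy_Schwarz_cinner[of x y] by (simp add: mult.commute)
qed (simp_all add: cinner_algebra scaleR_scaleC scaleC_complex_def)

lemma bounded_linear_scaleC: "bounded_linear (\<lambda>x::'a::complex_inner. c *\<^sub>C x)"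
proof (rule bounded_linear_intro)
  show "norm (c *\<^sub>C x) \<le> norm x * cmod c" for x :: 'a
    by (simp add: norm_scaleC)
qed (simp_all add: scaleC_add_right scaleR_scaleC scaleC_scaleC mult.commute)

section \<open>Orthogonal projection and adjoints\<close>

lemma parallelogram_law:
  "(norm (x + y))\<^sup>2 + (norm (x - y))\<^sup>2 = 2 * (norm x)\<^sup>2 + 2 * (norm (y::'a::complex_inner))\<^sup>2"
proof -
  have "complex_of_real ((norm (x + y))\<^sup>2 + (norm (x - y))\<^sup>2)
    = complex_of_real (2 * (norm x)\<^sup>2 + 2 * (norm y)\<^sup>2)"
    unfolding of_real_add of_real_mult cinner_self[symmetric] by (simp add: cinner_algebra)
  then show ?thesis
    unfolding of_real_eq_iff .
qed

text \<open>The point \<open>p\<close> is the limit of a minimizing sequence for the distance from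
  \<open>x\<close> to \<open>M\<close>; orthogonality is the first-order condition at the
  minimum.\<close>

lemma orthogonal_projection_exists:
  fixes x :: "'a::chilbert_space"
  assumes cl: "closed M" and zero: "0 \<in> M"
    and add: "\<And>u v. u \<in> M \<Longrightarrow> v \<in> M \<Longrightarrow> u + v \<in> M"
    and scale: "\<And>c u. u \<in> M \<Longrightarrow> c *\<^sub>C u \<in> M"
  obtains p where "p \<in> M" "\<And>m. m \<in> M \<Longrightarrow> cinner (x - p) m = 0"
proof -
  define D where "D = (INF m\<in>M. (norm (x - m))\<^sup>2)"
  have D: "D \<le> (norm (x - m))\<^sup>2" if "m \<in> M" for m
    unfolding D_def using that by (intro cINF_lower bdd_belowI[of _ 0]) auto
  have "\<exists>m\<in>M. (norm (x - m))\<^sup>2 < D + 1 / real (Suc n)" for n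
    using cInf_lessD[of "(\<lambda>m. (norm (x - m))\<^sup>2) ` M" "D + 1 / real (Suc n)"] zero
    by (auto simp: D_def)
  then obtain y where yM: "y n \<in> M" and y: "(norm (x - y n))\<^sup>2 < D + 1 / real (Suc n)" for n
    by metis
  have diff: "(norm (y m - y n))\<^sup>2 \<le> 2 / real (Suc m) + 2 / real (Suc n)" for m n
  proof -
    \<comment> \<open>The midpoint stays in \<open>M\<close>, so its squared distance from
      \<open>x\<close> is at least \<open>D\<close>. The parallelogram law turns this into a bound
      on the distance of \<open>y m\<close> and \<open>y n\<close>.\<close>
    define q where "q = (1/2) *\<^sub>C (y m + y n)"
    have q: "q \<in> M"
      unfolding q_def using yM by (intro scale add)
    have "(x - y n) + (x - y m) = 2 *\<^sub>C (x - q)"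
    proof -
      have "2 *\<^sub>C z = z + z" for z :: 'a
        using scaleC_add_left[of 1 1 z] by simp
      then show ?thesis
        by (simp add: scaleC_diff_right q_def scaleC_scaleC)
    qed
    then have "(norm ((x - y n) + (x - y m)))\<^sup>2 = 4 * (norm (x - q))\<^sup>2"
      by (simp add: norm_scaleC power_mult_distrib)
    then have "4 * (norm (x - q))\<^sup>2 + (norm (y m - y n))\<^sup>2
        = 2 * (norm (x - y n))\<^sup>2 + 2 * (norm (x - y m))\<^sup>2"
      using parallelogram_law[of "x - y n" "x - y m"] by simp
    then show ?thesis
      using D[OF q] y[of m] y[of n] by simp
  qed
  have "Cauchy y"
  proof (rule metric_CauchyI)
    fix e :: real assume e: "e > 0"
    obtain N where N: "4 / e\<^sup>2 < real N"
      using reals_Archimedean2 by blast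
    show "\<exists>M. \<forall>m\<ge>M. \<forall>n\<ge>M. dist (y m) (y n) < e"
    proof (intro exI allI impI)
      fix m n assume mn: "m \<ge> N" "n \<ge> N"
      have small: "2 / real (Suc k) < e\<^sup>2 / 2" if "k \<ge> N" for k
      proof -
        have "4 / e\<^sup>2 < real (Suc k)"
          using N that by simp
        then show ?thesis
          using e by (simp add: field_simps)
      qed
      have "(norm (y m - y n))\<^sup>2 < e\<^sup>2"
        using diff[of m n] small[OF mn(1)] small[OF mn(2)] by simp
      then show "dist (y m) (y n) < e"
        using e power2_less_imp_less[of "norm (y m - y n)" e] by (simp add: dist_norm)
    qed
  qed
  then obtain p where p: "y \<longlonglongrightarrow> p"
    using Cauchy_convergent convergent_def by blast
  have pM: "p \<in> M"
    using closed_sequentially[OF cl] yM p by blast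
  have "(norm (x - p))\<^sup>2 \<le> D + 0"
  proof (rule LIMSEQ_le)
    show "(\<lambda>n. (norm (x - y n))\<^sup>2) \<longlonglongrightarrow> (norm (x - p))\<^sup>2"
      by (intro tendsto_intros p)
    show "(\<lambda>n. D + 1 / real (Suc n)) \<longlonglongrightarrow> D + 0"
      by (intro tendsto_add tendsto_const) (rule LIMSEQ_Suc[OF lim_1_over_n])
    show "\<exists>N. \<forall>n\<ge>N. (norm (x - y n))\<^sup>2 \<le> D + 1 / real (Suc n)"
      using y less_imp_le by blast
  qed
  then have min: "(norm (x - p))\<^sup>2 \<le> (norm (x - m))\<^sup>2" if "m \<in> M" for m
    using D[OF that] by linarith
  have Re0: "Re (cinner (x - p) m) = 0" if m: "m \<in> M" for m
  proof -
    \<comment> \<open>Minimality of \<open>p\<close> against \<open>p - t m\<close>, expanded: the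
      terms \<open>(norm (x - p))\<^sup>2\<close> cancel, so the constant coefficient is 0 and the
      discriminant bound forces the linear one to vanish.\<close>
    have "0 \<le> 0 + 2 * t * Re (cinner (x - p) m) + t\<^sup>2 * (norm m)\<^sup>2" for t :: real
    proof -
      define r where "r = x - p"
      have "p + complex_of_real (- t) *\<^sub>C m \<in> M"
        by (intro add pM scale m)
      then have "(norm r)\<^sup>2 \<le> (norm (r + complex_of_real t *\<^sub>C m))\<^sup>2"
      proof -
        have "complex_of_real (- t) *\<^sub>C m = - (complex_of_real t *\<^sub>C m)"
          using scaleC_scaleC[of "-1" "complex_of_real t" m] by simp
        then show ?thesis
          using min[OF \<open>p + complex_of_real (- t) *\<^sub>C m \<in> M\<close>] by (simp add: r_def algebra_simps)
      qed
      moreover have "(norm z)\<^sup>2 = Re (cinner z z)" for z :: 'a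
        by (simp add: cinner_self)
      moreover have "Re (cinner m r) = Re (cinner r m)"
        by (subst cinner_commute) simp
      ultimately show ?thesis
        by (simp add: cinner_algebra power2_eq_square algebra_simps flip: r_def)
    qed
    then have "(Re (cinner (x - p) m))\<^sup>2 \<le> 0 * (norm m)\<^sup>2"
      by (rule nonneg_quadratic_discriminant) simp
    then show ?thesis
      by simp
  qed
  show thesis
  proof (rule that[OF pM])
    fix m assume m: "m \<in> M"
    show "cinner (x - p) m = 0"
      \<comment> \<open>Replacing \<open>m\<close> by \<open>\<i> *\<^sub>C m\<close> exposes the
        imaginary part.\<close>
      using Re0[OF m] Re0[OF scale[OF m, of \<i>]]
      by (simp add: cinner_scaleC_right complex_eq_iff)
  qed
qed

text \<open>The kernel of a nonzero \<open>f\<close> has codimension one. The part \<open>z\<close>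
  of some \<open>x0\<close> orthogonal to the kernel represents \<open>f\<close> up to a scalar,
  because \<open>x - (f x / f z) *\<^sub>C z\<close> lies in the kernel.\<close>

lemma Riesz_representation:
  fixes f :: "'a::chilbert_space \<Rightarrow> complex"
  assumes bl: "bounded_linear f" and homogeneous: "\<And>c x. f (c *\<^sub>C x) = c * f x"
  obtains z where "\<And>x. f x = cinner x z"
proof (cases "\<forall>x. f x = 0")
  case True
  then show ?thesis
    using that[of 0] by simp
next
  case False
  interpret bounded_linear f by (rule bl)
  obtain x0 where x0: "f x0 \<noteq> 0"
    using False by blast
  obtain p where p: "f p = 0" and orth: "\<And>m. f m = 0 \<Longrightarrow> cinner (x0 - p) m = 0"
  proof (rule orthogonal_projection_exists[of "{x. f x = 0}" x0])
    show "closed {x. f x = 0}"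
      by (intro closed_Collect_eq continuous_intros linear_continuous_on bl)
  qed (auto simp: zero add homogeneous)
  define z where "z = x0 - p"
  have fz: "f z \<noteq> 0"
    using x0 p by (simp add: z_def diff)
  then have zz: "cinner z z \<noteq> 0"
    by (auto simp: cinner_eq_zero_iff zero)
  show thesis
  proof (rule that)
    fix x
    have "f (x - (f x / f z) *\<^sub>C z) = 0"
      using fz by (simp add: diff homogeneous)
    then have "cinner z (x - (f x / f z) *\<^sub>C z) = 0"
      using orth by (simp add: z_def)
    then have "cinner (x - (f x / f z) *\<^sub>C z) z = 0"
      using cinner_commute complex_cnj_zero by metis
    then have "cinner x z = f x / f z * cinner z z"
      by (simp add: cinner_algebra)
    then show "f x = cinner x (cnj (f z / cinner z z) *\<^sub>C z)"
      using fz zz by (simp add: cinner_scaleC_right)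
  qed
qed

section \<open>The Hilbert space adjoint\<close>

lemma bounded_clinear_intro:
  assumes "\<And>x y. T (x + y) = T x + T y" "\<And>c x. T (c *\<^sub>C x) = c *\<^sub>C T x"
    "\<And>x. norm (T x) \<le> norm x * K"
  shows "bounded_clinear T"
proof -
  have "bounded_linear T"
    by (rule bounded_linear_intro[OF assms(1) _ assms(3)]) (simp add: scaleR_scaleC assms(2))
  then show ?thesis
    using assms(2) by (simp add: bounded_clinear_def)
qed

text \<open>Riesz representation supplies the values, and \<open>cinner_ext\<close> gives linearity
  and the uniqueness behind \<open>THE\<close>. Any bound \<open>K\<close> for \<open>T\<close>
  carries over by applying Cauchy-Schwarz to \<open>cinner (T (S x)) x\<close>.\<close>

lemma cadjoint:
  fixes T :: "'a::chilbert_space \<Rightarrow> 'a"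
  assumes T: "bounded_clinear T"
  shows "bounded_clinear (cadjoint T)" "cinner (T x) y = cinner x (cadjoint T y)"
proof -
  note D = bounded_clinearD[OF T]
  have "\<exists>z. \<forall>x. cinner (T x) y = cinner x z" for y
  proof (rule Riesz_representation[of "\<lambda>x. cinner (T x) y"])
    show "bounded_linear (\<lambda>x. cinner (T x) y)"
      using bounded_linear_compose[OF bounded_linear_cinner_left D(1)] by simp
  qed (auto simp: D cinner_algebra)
  then obtain S where S: "\<And>x y. cinner (T x) y = cinner x (S y)"
    by metis
  obtain K where K: "\<And>x. norm (T x) \<le> norm x * K"
    using bounded_linear.bounded[OF D(1)] by blast
  have "bounded_clinear S"
  proof (rule bounded_clinear_intro)
    show "S (x + y) = S x + S y" for x y
      by (rule cinner_ext) (simp add: S[symmetric] cinner_algebra)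
    show "S (c *\<^sub>C x) = c *\<^sub>C S x" for c x
      by (rule cinner_ext) (simp add: S[symmetric] cinner_algebra)
    show "norm (S x) \<le> norm x * K" for x
    proof (cases "S x = 0")
      case True
      have "0 \<le> norm x * K"
        by (rule order_trans[OF norm_ge_zero K])
      then show ?thesis
        using True by simp
    next
      case False
      have "(norm (S x))\<^sup>2 = cmod (cinner (T (S x)) x)"
        by (simp add: S cinner_self norm_power)
      also have "\<dots> \<le> norm (S x) * K * norm x"
        by (rule order_trans[OF Cauchy_Schwarz_cinner mult_right_mono[OF K norm_ge_zero]])
      finally show ?thesis
        using False by (simp add: power2_eq_square mult.assoc mult.commute[of K])
    qed
  qed
  let ?P = "\<lambda>S. bounded_clinear S \<and> (\<forall>x y. cinner (T x) y = cinner x (S y))"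
  have "?P (cadjoint T)"
    unfolding cadjoint_def
  proof (rule theI[of ?P S])
    show "?P S"
      using S \<open>bounded_clinear S\<close> by simp
    fix S' assume "?P S'"
    then have "cinner x (S' y) = cinner x (S y)" for x y
      using S by simp
    then show "S' = S"
      by (rule ext[OF cinner_ext])
  qed
  then show "bounded_clinear (cadjoint T)" "cinner (T x) y = cinner x (cadjoint T y)"
    by blast+
qed

section \<open>The reduced \<open>A\<close>-adjoint\<close>

text \<open>Together with the next two lemmas this makes \<open>closure (range A)\<close> a subspace
  onto which \<open>orthogonal_projection_exists\<close> can project.\<close>

lemma closure_range_add:
  assumes A: "bounded_clinear A" and "u \<in> closure (range A)" "v \<in> closure (range A)"
  shows "u + v \<in> closure (range A)"
proof -
  obtain f g where f: "\<And>n. f n \<in> range A" "f \<longlonglongrightarrow> u"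
    and g: "\<And>n. g n \<in> range A" "g \<longlonglongrightarrow> v"
    using assms(2,3) unfolding closure_sequential by blast
  have "f n + g n \<in> range A" for n
  proof -
    obtain y z where "f n = A y" "g n = A z"
      using f(1) g(1) by blast
    then have "f n + g n = A (y + z)"
      by (simp add: bounded_clinearD(3)[OF A])
    then show ?thesis
      by simp
  qed
  then show ?thesis
    using tendsto_add[OF f(2) g(2)]
    unfolding closure_sequential by (intro exI[of _ "\<lambda>n. f n + g n"]) simp
qed

lemma closure_range_scaleC:
  assumes A: "bounded_clinear A" and "u \<in> closure (range A)"
  shows "c *\<^sub>C u \<in> closure (range A)"
proof -
  obtain f where f: "\<And>n. f n \<in> range A" "f \<longlonglongrightarrow> u"
    using assms(2) unfolding closure_sequential by blast
  have "c *\<^sub>C f n \<in> range A" for n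
  proof -
    obtain y where "f n = A y"
      using f(1) by blast
    then have "c *\<^sub>C f n = A (c *\<^sub>C y)"
      by (simp add: bounded_clinearD(2)[OF A])
    then show ?thesis
      by simp
  qed
  then show ?thesis
    using bounded_linear.tendsto[OF bounded_linear_scaleC f(2)]
    unfolding closure_sequential by (intro exI[of _ "\<lambda>n. c *\<^sub>C f n"]) simp
qed

lemma closure_range_zero:
  assumes "bounded_clinear A"
  shows "0 \<in> closure (range A)"
proof -
  have "A 0 \<in> closure (range A)"
    by (rule subsetD[OF closure_subset rangeI])
  then show ?thesis
    by (simp add: bounded_clinearD(6)[OF assms])
qed

lemma positive_op_selfadjoint:
  assumes "positive_op A"
  shows "cinner (A x) y = cinner x (A y)"
  using A_inner_commute[OF assms, of x y] cinner_commute[of x "A y"] by (simp add: A_inner_def)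

text \<open>A kernel vector is orthogonal to the range of the selfadjoint \<open>A\<close>, hence by
  continuity to its closure, and so to itself. This is the source of uniqueness for
  \<open>A_sharp\<close>.\<close>

lemma closure_range_kernel:
  fixes A :: "'a::chilbert_space \<Rightarrow> 'a"
  assumes A: "positive_op A" and u: "u \<in> closure (range A)" and Au: "A u = 0"
  shows "u = 0"
proof -
  have "closed {v. cinner u v = 0}"
    by (intro closed_Collect_eq continuous_intros linear_continuous_on bounded_linear_cinner_right)
  moreover have "range A \<subseteq> {v. cinner u v = 0}"
    using Au by (auto simp: positive_op_selfadjoint[OF A, symmetric])
  ultimately have "cinner u u = 0"
    using u closure_minimal by blast
  then show ?thesis
    by (simp add: cinner_eq_zero_iff)
qed

text \<open>Any solution \<open>z\<close> of \<open>A z = cadjoint T (A x)\<close>, projected onto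
  \<open>closure (range A)\<close>, gives the value at \<open>x\<close>. Injectivity of
  \<open>A\<close> on that closure yields both linearity and uniqueness.\<close>

lemma A_sharp:
  fixes A T :: "'a::chilbert_space \<Rightarrow> 'a"
  assumes A: "positive_op A" and TA: "T \<in> A_bounded A"
  shows "bounded_clinear (A_sharp A T)" "A (A_sharp A T x) = cadjoint T (A x)"
    "A_sharp A T x \<in> closure (range A)"
proof -
  note Alin = positive_opD(1)[OF A]
  note AD = bounded_clinearD[OF Alin]
  have T: "bounded_clinear T"
    using TA by (simp add: A_bounded_def)
  note adj = cadjoint[OF T]
  note adjD = bounded_clinearD[OF adj(1)]
  let ?R = "closure (range A)"
  note R = closure_range_add[OF Alin] closure_range_scaleC[OF Alin] closure_range_zero[OF Alin]
  have Rdiff: "u - v \<in> ?R" if "u \<in> ?R" "v \<in> ?R" for u v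
    using R(1)[OF that(1) R(2)[OF that(2), of "-1"]] by simp
  have uniq: "u = v" if "u \<in> ?R" "v \<in> ?R" "A u = A v" for u v
    using closure_range_kernel[OF A Rdiff[OF that(1,2)]] that(3) by (simp add: AD)
  have "\<exists>u\<in>?R. A u = cadjoint T (A x)" for x
  proof -
    have "(cadjoint T \<circ> A) x \<in> range A"
      using TA unfolding A_bounded_def by blast
    then obtain z where z: "A z = cadjoint T (A x)"
      by auto
    obtain p where p: "p \<in> ?R" "\<And>m. m \<in> ?R \<Longrightarrow> cinner (z - p) m = 0"
      using orthogonal_projection_exists[of ?R z] R by blast
    \<comment> \<open>Since \<open>z - p\<close> is orthogonal to the range, \<open>A\<close>
      annihilates it; projecting therefore preserves the equation.\<close>
    have "cinner y (A (z - p)) = cinner y 0" for y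
      using p(2)[of "A y"] closure_subset[of "range A"] cinner_commute[of "z - p" "A y"]
      by (auto simp: positive_op_selfadjoint[OF A, symmetric])
    then have "A (z - p) = 0"
      by (rule cinner_ext)
    then have "A p = cadjoint T (A x)"
      using z by (simp add: AD)
    then show ?thesis
      using p by blast
  qed
  then obtain X where XR: "\<And>x. X x \<in> ?R" and AX: "\<And>x. A (X x) = cadjoint T (A x)"
    by metis
  have inner: "cinner (X x) (A v) = cinner x (A (T v))" for x v
    by (metis AX adj(2) cinner_commute positive_op_selfadjoint[OF A])
  \<comment> \<open>The family is indexed by the \<open>v\<close> with
    \<open>norm (A v) \<le> 1\<close>. By \<open>inner\<close> and Cauchy-Schwarz it is bounded at
    each \<open>x\<close> by \<open>norm (X x)\<close>.\<close>
  obtain K where K: "K \<ge> 0"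
    "\<And>v x. v \<in> {v. norm (A v) \<le> 1} \<Longrightarrow> cmod (cinner x (A (T v))) \<le> K * norm x"
  proof (rule uniform_boundedness[of "{v. norm (A v) \<le> 1}" "\<lambda>v x. cinner x (A (T v))"])
    show "bounded_linear (\<lambda>x. cinner x (A (T v)))" for v
      by (rule bounded_linear_cinner_left)
    show "\<exists>c. \<forall>v\<in>{v. norm (A v) \<le> 1}. cmod (cinner x (A (T v))) \<le> c" for x
    proof (intro exI ballI)
      fix v assume "v \<in> {v. norm (A v) \<le> 1}"
      then have "norm (X x) * norm (A v) \<le> norm (X x)"
        by (simp add: mult_left_le)
      then show "cmod (cinner x (A (T v))) \<le> norm (X x)"
        using Cauchy_Schwarz_cinner[of "X x" "A v"] by (simp add: inner)
    qed
  qed auto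
  have bound: "cmod (cinner (X x) (A v)) \<le> K * norm x * norm (A v)" for x v
  proof (cases "A v = 0")
    case False
    define c where "c = complex_of_real (1 / norm (A v))"
    have c: "cmod c = 1 / norm (A v)"
      by (simp add: c_def norm_divide)
    have Ac: "A (c *\<^sub>C v) = c *\<^sub>C A v"
      by (rule AD)
    have "norm (A (c *\<^sub>C v)) \<le> 1"
      using False by (simp add: Ac norm_scaleC c)
    then have "cmod (cinner (X x) (A (c *\<^sub>C v))) \<le> K * norm x"
      using K(2) by (simp add: inner)
    then show ?thesis
      using False by (simp add: Ac cinner_scaleC_right norm_mult c field_simps)
  qed simp
  have "bounded_clinear X"
  proof (rule bounded_clinear_intro)
    show "X (x + y) = X x + X y" for x y
      by (rule uniq) (simp_all add: XR R AX AD adjD)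
    show "X (c *\<^sub>C x) = c *\<^sub>C X x" for c x
      by (rule uniq) (simp_all add: XR R AX AD adjD)
    show "norm (X x) \<le> norm x * K" for x
    proof -
      \<comment> \<open>The estimate passes from the range of \<open>A\<close> to its closure, where
        \<open>u = X x\<close> is an admissible choice.\<close>
      have "closed {u. cmod (cinner (X x) u) \<le> K * norm x * norm u}"
        by (intro closed_Collect_le continuous_intros linear_continuous_on
            bounded_linear_cinner_right)
      moreover have "range A \<subseteq> {u. cmod (cinner (X x) u) \<le> K * norm x * norm u}"
        using bound by blast
      ultimately have "cmod (cinner (X x) (X x)) \<le> K * norm x * norm (X x)"
        using XR[of x] closure_minimal by blast
      then show ?thesis
        using K(1) by (cases "X x = 0") (simp_all add: cinner_self norm_mult power2_eq_square mult.commute)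
    qed
  qed
  let ?P = "\<lambda>X. bounded_clinear X \<and> A \<circ> X = cadjoint T \<circ> A \<and> range X \<subseteq> ?R"
  have "?P (A_sharp A T)"
    unfolding A_sharp_def
  proof (rule theI[of ?P X])
    show "?P X"
      using XR AX \<open>bounded_clinear X\<close> by auto
    fix Y assume Y: "?P Y"
    show "Y = X"
    proof
      fix x
      have "(A \<circ> Y) x = (cadjoint T \<circ> A) x"
        using Y by simp
      then have "A (Y x) = A (X x)"
        by (simp add: AX)
      moreover have "Y x \<in> ?R"
        using Y by blast
      ultimately show "Y x = X x"
        using uniq XR by blast
    qed
  qed
  then have X: "bounded_clinear (A_sharp A T)" "A \<circ> A_sharp A T = cadjoint T \<circ> A"
    "range (A_sharp A T) \<subseteq> ?R"
    by blast+
  show "bounded_clinear (A_sharp A T)" "A_sharp A T x \<in> ?R"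
    using X by blast+
  show "A (A_sharp A T x) = cadjoint T (A x)"
    using fun_cong[OF X(2), of x] by simp
qed

text \<open>Moving \<open>A\<close> across the inner product before and after passing to
  \<open>cadjoint T\<close> turns the defining equation of \<open>A_sharp\<close> into this adjoint
  relation.\<close>

lemma A_inner_sharp:
  assumes "positive_op A" "T \<in> A_bounded A"
  shows "A_inner A (T x) y = A_inner A x (A_sharp A T y)"
proof -
  have "bounded_clinear T"
    using assms by (simp add: A_bounded_def)
  then show ?thesis
    unfolding A_inner_def
    by (metis assms A_sharp(2) cadjoint(2) positive_op_selfadjoint)
qed

lemma A_inner_sharp':
  assumes "positive_op A" "T \<in> A_bounded A"
  shows "A_inner A (A_sharp A T x) y = A_inner A x (T y)"
  by (metis assms A_inner_sharp A_inner_commute)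

section \<open>Boundedness with respect to the seminorm\<close>

text \<open>If \<open>a / c\<close> exceeded 1, its powers would outgrow the fixed factor
  \<open>M\<close>. The lemma thus discards constants from bounds on iterates.\<close>

lemma exponential_bound_imp_le:
  fixes a c M :: real
  assumes "c > 0" and bound: "\<And>n::nat. a ^ (2 ^ n) \<le> M * c ^ (2 ^ n)"
  shows "a \<le> c"
proof (rule ccontr)
  assume "\<not> a \<le> c"
  then have "1 < a / c"
    using \<open>c > 0\<close> by simp
  then obtain n where n: "M < (a / c) ^ n"
    using real_arch_pow by blast
  also have "\<dots> \<le> (a / c) ^ (2 ^ n)"
    using \<open>1 < a / c\<close> by (intro power_increasing) (auto simp: less_imp_le)
  finally have "M * c ^ (2 ^ n) < a ^ (2 ^ n)"
    using \<open>c > 0\<close> by (simp add: power_divide field_simps)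
  then show False
    using bound[of n] by simp
qed

text \<open>Iterating \<open>\<parallel>S\<^sup>m x\<parallel>\<^sub>A\<^sup>2 = \<langle>x, S\<^sup>2\<^sup>m x\<rangle>\<^sub>A \<le> \<parallel>S\<^sup>2\<^sup>m x\<parallel>\<^sub>A\<close> along powers of two
  bounds the seminorm of \<open>S x\<close> by the operator norm of \<open>S\<close>.\<close>

lemma A_selfadjoint_bounded:
  fixes S :: "'a::complex_inner \<Rightarrow> 'a"
  assumes A: "positive_op A" and S: "bounded_linear S"
    and sa: "\<And>x y. A_inner A (S x) y = A_inner A x (S y)"
  obtains K where "K > 0" "\<And>x. A_seminorm A x = 1 \<Longrightarrow> A_seminorm A (S x) \<le> K"
proof -
  obtain K where K: "K > 0" "\<And>x. norm (S x) \<le> norm x * K"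
    using bounded_linear.pos_bounded[OF S] by blast
  obtain L where L: "L > 0" "\<And>x. norm (A x) \<le> norm x * L"
    using bounded_linear.pos_bounded[OF bounded_clinearD(1)[OF positive_opD(1)[OF A]]] by blast
  \<comment> \<open>This comparison enters only through the factor in front of
    \<open>K ^ (2 ^ n)\<close>, which disappears in the limit.\<close>
  have seminorm_le: "A_seminorm A x \<le> sqrt L * norm x" for x
  proof -
    have "Re (A_inner A x x) \<le> norm (A x) * norm x"
      unfolding A_inner_def using Cauchy_Schwarz_cinner complex_Re_le_cmod order_trans by blast
    also have "\<dots> \<le> L * (norm x)\<^sup>2"
      using mult_right_mono[OF L(2)[of x] norm_ge_zero[of x]]
      by (simp add: power2_eq_square mult_ac)
    finally have "A_seminorm A x \<le> sqrt (L * (norm x)\<^sup>2)"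
      by (simp add: A_seminorm_def)
    then show ?thesis
      by (simp add: real_sqrt_mult)
  qed
  have sa_pow: "A_inner A ((S ^^ m) x) y = A_inner A x ((S ^^ m) y)" for m x y
    by (induction m arbitrary: x y) (simp_all add: sa funpow_swap1)
  have norm_pow: "norm ((S ^^ m) x) \<le> norm x * K ^ m" for m x
  proof (induction m)
    case (Suc m)
    have "norm ((S ^^ Suc m) x) \<le> norm ((S ^^ m) x) * K"
      using K(2) by simp
    also have "\<dots> \<le> norm x * K ^ m * K"
      using Suc K(1) by (intro mult_right_mono) auto
    finally show ?case
      by (simp add: mult_ac)
  qed simp
  show thesis
  proof (rule that[OF K(1)])
    fix x assume x: "A_seminorm A x = 1"
    have double: "(A_seminorm A ((S ^^ m) x))\<^sup>2 \<le> A_seminorm A ((S ^^ (2 * m)) x)" for m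
    proof -
      have "complex_of_real ((A_seminorm A ((S ^^ m) x))\<^sup>2)
          = A_inner A ((S ^^ m) x) ((S ^^ m) x)"
        by (rule A_inner_self[OF A, symmetric])
      also have "\<dots> = A_inner A x ((S ^^ (2 * m)) x)"
        by (simp add: sa_pow mult_2 funpow_add)
      finally have "(A_seminorm A ((S ^^ m) x))\<^sup>2 = cmod (A_inner A x ((S ^^ (2 * m)) x))"
        by (metis abs_power2 norm_of_real)
      then show ?thesis
        using A_Cauchy_Schwarz[OF A, of x "(S ^^ (2 * m)) x"] x by simp
    qed
    have iter: "A_seminorm A (S x) ^ (2 ^ n) \<le> A_seminorm A ((S ^^ (2 ^ n)) x)" for n
    proof (induction n)
      case (Suc n)
      have "A_seminorm A (S x) ^ (2 ^ Suc n) = (A_seminorm A (S x) ^ (2 ^ n))\<^sup>2"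
        by (simp add: mult.commute flip: power_mult)
      also have "\<dots> \<le> (A_seminorm A ((S ^^ (2 ^ n)) x))\<^sup>2"
        using Suc A_seminorm_nonneg[OF A] by (intro power_mono) auto
      finally show ?case
        using double[of "2 ^ n"] by simp
    qed simp
    show "A_seminorm A (S x) \<le> K"
    proof (rule exponential_bound_imp_le[OF K(1)])
      fix n :: nat
      have "A_seminorm A (S x) ^ (2 ^ n) \<le> sqrt L * norm ((S ^^ (2 ^ n)) x)"
        using iter seminorm_le order_trans by blast
      also have "\<dots> \<le> sqrt L * (norm x * K ^ (2 ^ n))"
        using L(1) norm_pow by (intro mult_left_mono) auto
      finally show "A_seminorm A (S x) ^ (2 ^ n) \<le> (sqrt L * norm x) * K ^ (2 ^ n)"
        by (simp add: mult_ac)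
    qed
  qed
qed

text \<open>The product of \<open>A_sharp A T\<close> and \<open>T\<close> is selfadjoint for the
  semi-inner product, and its form at \<open>x\<close> is the squared seminorm of
  \<open>T x\<close>. The selfadjoint case thus applies and makes the set defining the numerical
  radius bounded above.\<close>

lemma A_bounded_imp_seminorm_bounded:
  fixes A T :: "'a::chilbert_space \<Rightarrow> 'a"
  assumes A: "positive_op A" and TA: "T \<in> A_bounded A"
  obtains K where "\<And>x. A_seminorm A x = 1 \<Longrightarrow> A_seminorm A (T x) \<le> K"
proof -
  define S where "S = A_sharp A T \<circ> T"
  have "bounded_linear T"
    using TA by (simp add: A_bounded_def bounded_clinear_def)
  then have lin: "bounded_linear S"
    unfolding S_def comp_def
    using bounded_linear_compose bounded_clinearD(1)[OF A_sharp(1)[OF A TA]] by blast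
  have sa: "A_inner A (S x) y = A_inner A (T x) (T y)"
    "A_inner A x (S y) = A_inner A (T x) (T y)" for x y
    by (simp_all add: S_def A_inner_sharp[OF A TA] A_inner_sharp'[OF A TA])
  have "A_inner A (S x) y = A_inner A x (S y)" for x y
    by (simp add: sa)
  then obtain K where K: "K > 0" "\<And>x. A_seminorm A x = 1 \<Longrightarrow> A_seminorm A (S x) \<le> K"
    using A_selfadjoint_bounded[OF A lin] by blast
  show thesis
  proof
    fix x assume x: "A_seminorm A x = 1"
    have "(A_seminorm A (T x))\<^sup>2 = cmod (A_inner A x (S x))"
      by (simp add: sa A_inner_self[OF A] norm_power)
    also have "\<dots> \<le> K"
      using A_Cauchy_Schwarz[OF A, of x "S x"] K(2)[OF x] x by simp
    finally show "A_seminorm A (T x) \<le> sqrt K"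
      by (rule real_le_rsqrt)
  qed
qed

section \<open>Numerical radius and seminorm\<close>

lemma A_numerical_radius_ge:
  fixes A T :: "'a::chilbert_space \<Rightarrow> 'a"
  assumes A: "positive_op A" and TA: "T \<in> A_bounded A"
  shows "cmod (A_inner A (T x) x) \<le> A_numerical_radius A T * (A_seminorm A x)\<^sup>2"
    and "0 \<le> A_numerical_radius A T"
proof -
  let ?W = "insert 0 {cmod (A_inner A (T x) x) | x. A_seminorm A x = 1}"
  obtain K where K: "\<And>x. A_seminorm A x = 1 \<Longrightarrow> A_seminorm A (T x) \<le> K"
    using A_bounded_imp_seminorm_bounded[OF A TA] by blast
  have "cmod (A_inner A (T x) x) \<le> K" if "A_seminorm A x = 1" for x
    using A_Cauchy_Schwarz[OF A, of "T x" x] K[OF that] that by simp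
  then have bdd: "bdd_above ?W"
    by (intro bdd_aboveI[of _ "max 0 K"]) (auto simp: max.coboundedI2)
  have unit: "cmod (A_inner A (T x) x) \<le> A_numerical_radius A T" if "A_seminorm A x = 1" for x
    unfolding A_numerical_radius_def using that by (intro cSup_upper bdd) auto
  \<comment> \<open>The inserted 0 settles this even if no vector has seminorm 1.\<close>
  show "0 \<le> A_numerical_radius A T"
    unfolding A_numerical_radius_def by (intro cSup_upper bdd) auto
  have T: "bounded_clinear T"
    using TA by (simp add: A_bounded_def)
  show "cmod (A_inner A (T x) x) \<le> A_numerical_radius A T * (A_seminorm A x)\<^sup>2"
  \<comment> \<open>A vector of seminorm zero cannot be normalized, but Cauchy-Schwarz makes the
    left side vanish.\<close>
  proof (cases "A_seminorm A x = 0")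
    case True
    then show ?thesis
      using A_Cauchy_Schwarz[OF A, of "T x" x] by simp
  next
    case False
    define c where "c = complex_of_real (1 / A_seminorm A x)"
    have s: "A_seminorm A x > 0"
      using False A_seminorm_nonneg[OF A, of x] by simp
    have "A_seminorm A (c *\<^sub>C x) = 1"
      using s by (simp add: A_seminorm_scaleC[OF A] c_def norm_divide)
    from unit[OF this] show ?thesis
      using s by (simp add: bounded_clinearD[OF T] A_inner_algebra[OF positive_opD(1)[OF A]]
          c_def norm_mult norm_divide power2_eq_square field_simps)
  qed
qed

text \<open>With \<open>y\<close> the normalization of \<open>R x\<close>, the forms of
  \<open>R\<close> at \<open>x + y\<close> and \<open>x - y\<close> differ by four times the
  seminorm of \<open>R x\<close>. The parallelogram law bounds the difference by
  \<open>4 * w\<close>.\<close>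

lemma A_selfadjoint_seminorm_le:
  fixes R :: "'a::complex_inner \<Rightarrow> 'a"
  assumes A: "positive_op A"
    and add: "\<And>x y. R (x + y) = R x + R y" and diff: "\<And>x y. R (x - y) = R x - R y"
    and sa: "\<And>x y. A_inner A (R x) y = A_inner A x (R y)"
    and w: "\<And>x. cmod (A_inner A (R x) x) \<le> w * (A_seminorm A x)\<^sup>2" "0 \<le> w"
    and x: "A_seminorm A x = 1"
  shows "A_seminorm A (R x) \<le> w"
proof (cases "A_seminorm A (R x) = 0")
  case False
  note alg = A_inner_algebra[OF positive_opD(1)[OF A]] and self = A_inner_self[OF A]
  define s where "s = A_seminorm A (R x)"
  have s: "s > 0"
    using False A_seminorm_nonneg[OF A, of "R x"] by (simp add: s_def)
  define y where "y = complex_of_real (1 / s) *\<^sub>C R x"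
  have y: "A_seminorm A y = 1"
    using s by (simp add: y_def A_seminorm_scaleC[OF A] norm_divide flip: s_def)
  have xy: "A_inner A (R x) y = s"
    using s by (simp add: y_def alg self power2_eq_square flip: s_def)
  \<comment> \<open>Selfadjointness makes this the conjugate of \<open>xy\<close>, which is
    real.\<close>
  have yx: "A_inner A (R y) x = s"
    using xy by (simp add: sa[of y x] A_inner_commute[OF A, of y "R x"])
  have sq: "(A_seminorm A z)\<^sup>2 = Re (A_inner A z z)" for z
    by (simp add: self)
  have "4 * s = Re (A_inner A (R (x + y)) (x + y)) - Re (A_inner A (R (x - y)) (x - y))"
    by (simp add: add diff alg xy yx)
  also have "\<dots> \<le> w * (A_seminorm A (x + y))\<^sup>2 + w * (A_seminorm A (x - y))\<^sup>2"
    using w(1)[of "x + y"] w(1)[of "x - y"]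
      abs_Re_le_cmod[of "A_inner A (R (x + y)) (x + y)"]
      abs_Re_le_cmod[of "A_inner A (R (x - y)) (x - y)"]
    by linarith
  also have "\<dots> = w * (2 * (A_seminorm A x)\<^sup>2 + 2 * (A_seminorm A y)\<^sup>2)"
    by (simp add: sq alg algebra_simps)
  finally show ?thesis
    using x y by (simp add: s_def)
qed (use w in simp)

lemma A_norm_upper:
  assumes "\<And>x. A_seminorm A x = 1 \<Longrightarrow> A_seminorm A (R x) \<le> w" "0 \<le> w"
  shows "A_norm A R \<le> w"
  unfolding A_norm_def using assms by (intro cSup_least) auto

text \<open>Here \<open>w\<close> certifies that the set of values is bounded above, so that
  \<open>Sup\<close> really is an upper bound.\<close>

lemma A_norm_lower:
  assumes "\<And>x. A_seminorm A x = 1 \<Longrightarrow> A_seminorm A (R x) \<le> w" "0 \<le> w"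
  shows "x \<in> closure (range A) \<Longrightarrow> A_seminorm A x = 1 \<Longrightarrow> A_seminorm A (R x) \<le> A_norm A R"
    and "0 \<le> A_norm A R"
proof -
  have "bdd_above (insert 0 {A_seminorm A (R x) | x. x \<in> closure (range A) \<and> A_seminorm A x = 1})"
    using assms by (intro bdd_aboveI[of _ w]) auto
  then show "x \<in> closure (range A) \<Longrightarrow> A_seminorm A x = 1 \<Longrightarrow> A_seminorm A (R x) \<le> A_norm A R"
    "0 \<le> A_norm A R"
    unfolding A_norm_def by (auto intro!: cSup_upper)
qed

text \<open>The real and imaginary parts of \<open>A_inner A (T z) z\<close> do not exceed its
  modulus, so \<open>A_selfadjoint_seminorm_le\<close> applies with the numerical radius of
  \<open>T\<close> as \<open>w\<close>.\<close>

lemma A_Re_Im_seminorm_le: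
  fixes A T :: "'a::chilbert_space \<Rightarrow> 'a"
  assumes A: "positive_op A" and TA: "T \<in> A_bounded A" and x: "A_seminorm A x = 1"
  shows "A_seminorm A (A_Re A T x) \<le> A_numerical_radius A T"
    and "A_seminorm A (A_Im A T x) \<le> A_numerical_radius A T"
proof -
  note alg = A_inner_algebra[OF positive_opD(1)[OF A]]
  note sharp = A_inner_sharp[OF A TA] A_inner_sharp'[OF A TA]
  note w = A_numerical_radius_ge[OF A TA]
  have T: "bounded_clinear T"
    using TA by (simp add: A_bounded_def)
  note D = bounded_clinearD[OF T] bounded_clinearD[OF A_sharp(1)[OF A TA]]
  have sharp_self: "A_inner A z (T z) = cnj (A_inner A (T z) z)" for z
    by (rule A_inner_commute[OF A])
  show "A_seminorm A (A_Re A T x) \<le> A_numerical_radius A T"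
  proof (rule A_selfadjoint_seminorm_le[OF A _ _ _ _ w(2) x])
    show "cmod (A_inner A (A_Re A T z) z) \<le> A_numerical_radius A T * (A_seminorm A z)\<^sup>2" for z
    proof -
      have "A_inner A (A_Re A T z) z = complex_of_real (Re (A_inner A (T z) z))"
        by (simp add: A_Re_def alg sharp(2) sharp_self complex_eq_iff)
      then show ?thesis
        using w(1)[of z] abs_Re_le_cmod[of "A_inner A (T z) z"] by simp
    qed
    show "A_inner A (A_Re A T y) z = A_inner A y (A_Re A T z)" for y z
      by (simp add: A_Re_def alg sharp(2)) (simp add: sharp(1))
  qed (simp_all add: A_Re_def D scaleC_add_right scaleC_diff_right algebra_simps)
  show "A_seminorm A (A_Im A T x) \<le> A_numerical_radius A T"
  proof (rule A_selfadjoint_seminorm_le[OF A _ _ _ _ w(2) x])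
    show "cmod (A_inner A (A_Im A T z) z) \<le> A_numerical_radius A T * (A_seminorm A z)\<^sup>2" for z
    proof -
      have "A_inner A (A_Im A T z) z = complex_of_real (Im (A_inner A (T z) z))"
        by (simp add: A_Im_def alg sharp(2) sharp_self complex_eq_iff)
      then show ?thesis
        using w(1)[of z] abs_Im_le_cmod[of "A_inner A (T z) z"] by simp
    qed
    show "A_inner A (A_Im A T y) z = A_inner A y (A_Im A T z)" for y z
      by (simp add: A_Im_def alg sharp(2)) (simp add: sharp(1) algebra_simps)
  qed (simp_all add: A_Im_def D scaleC_add_right scaleC_diff_right algebra_simps)
qed

theorem theorem2p1:
  fixes A T :: "'a::chilbert_space \<Rightarrow> 'a"
  assumes "positive_op A"
    and "T \<in> A_bounded A"
  shows "A_numerical_radius A T \<ge>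
    A_norm A T / 2 + \<bar>A_norm A (A_Re A T) - A_norm A (A_Im A T)\<bar> / 2"
proof -
  note w0 = A_numerical_radius_ge(2)[OF assms]
  note le = A_Re_Im_seminorm_le[OF assms]
  have ReIm: "A_norm A (A_Re A T) \<le> A_numerical_radius A T"
    "A_norm A (A_Im A T) \<le> A_numerical_radius A T"
    using A_norm_upper le w0 by blast+
  have nonneg: "0 \<le> A_norm A (A_Re A T)" "0 \<le> A_norm A (A_Im A T)"
    using A_norm_lower(2) le w0 by blast+
  \<comment> \<open>Vectors in \<open>closure (range A)\<close> suffice, since the supremum defining
    \<open>A_norm A T\<close> ranges over the same ones.\<close>
  have lower: "A_seminorm A (A_Re A T x) \<le> A_norm A (A_Re A T)"
    "A_seminorm A (A_Im A T x) \<le> A_norm A (A_Im A T)"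
    if "x \<in> closure (range A)" "A_seminorm A x = 1" for x
    using A_norm_lower(1) le w0 that by blast+
  have decomp: "T x = A_Re A T x + \<i> *\<^sub>C A_Im A T x" for x
  proof -
    have "T x = (1/2) *\<^sub>C T x + (1/2) *\<^sub>C T x"
      by (simp flip: scaleC_add_left)
    then show ?thesis
      by (simp add: A_Re_def A_Im_def scaleC_scaleC scaleC_add_right scaleC_diff_right)
  qed
  have "A_norm A T \<le> A_norm A (A_Re A T) + A_norm A (A_Im A T)"
    unfolding A_norm_def[of A T]
  proof (rule cSup_least)
    fix r assume "r \<in> insert 0 {A_seminorm A (T x) | x. x \<in> closure (range A) \<and> A_seminorm A x = 1}"
    then consider "r = 0" | x where "r = A_seminorm A (T x)" "x \<in> closure (range A)"
      "A_seminorm A x = 1"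
      by blast
    then show "r \<le> A_norm A (A_Re A T) + A_norm A (A_Im A T)"
    proof cases
      case 1
      then show ?thesis
        using nonneg by simp
    next
      case 2
      have "r \<le> A_seminorm A (A_Re A T x) + A_seminorm A (A_Im A T x)"
        using A_seminorm_triangle[OF assms(1), of "A_Re A T x" "\<i> *\<^sub>C A_Im A T x"]
        by (simp add: 2 decomp[of x, symmetric] A_seminorm_scaleC[OF assms(1)])
      then show ?thesis
        using lower[OF 2(2,3)] by simp
    qed
  qed simp
  moreover have "n / 2 + \<bar>a - b\<bar> / 2 \<le> w" if "n \<le> a + b" "a \<le> w" "b \<le> w" for n a b w :: real
    using that by (simp add: abs_real_def field_simps)
  ultimately show ?thesis
    using ReIm by blast
qed

end
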